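(* Consider the system, basis functions, data and data matrices described in the context, and assume Assumptions (A1), (A2), (A3) stated there. Let $r>0$ be such that $\mathcal{B}_r\subseteq\mathbb{X}$, and let $\bar{\mathcal{Q}}$ be the finite vertex set defined in the context. Suppose there exist a symmetric matrix $\bar\Gamma\in\mathbb{R}^{n\times n}$ with $\bar\Gamma\succ0$, a real number $\epsilon_{\bar\Gamma}>0$ and a matrix $\bar Y\in\mathbb{R}^{m\times n}$ such that $$\begin{bmatrix}-\bar\Gamma-\mathbf{C} & 0 & \mathbf{B} \\ 0 & -\bar\Gamma+\epsilon_{\bar\Gamma}I_n & -\begin{bmatrix}\bar\Gamma \\ \bar Y\end{bmatrix}^\top Q^\top \\ \mathbf{B}^\top & -Q\begin{bmatrix}\bar\Gamma \\ \bar Y\end{bmatrix} & -\mathbf{A}\end{bmatrix}\preceq0\qquad\text{for all }Q\in\bar{\mathcal{Q}} .$$ Let $u=Kx$ with $K=\bar Y\bar\Gamma^{-1}$. Then $\mathcal{B}_{\bar r_0}$, with $$\bar r_0=\min\left\{r,\ \sqrt{\frac{\lambda_{\max}(\bar\Gamma)\lambda_{\min}(\bar\Gamma)}{\lambda_{\max}^2(\bar\Gamma)-\epsilon_{\bar\Gamma}\lambda_{\min}(\bar\Gamma)}}\cdot r\right\}$$ (the quotient being read as $+\infty$ if its denominator is $0$), is a region of attraction of the closed-loop system $x^{+}=(A(x)+B(x)K)x$ relative to the equilibrium $0$, and the closed-loop system starting from any $x(0)\in\mathcal{B}_{\bar r_0}$ exponentially converges to the origin.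
   Context: System: $n,m\ge1$; $\mathbb{X}\subseteq\mathbb{R}^n$ contains the origin; $A(x)=[a_{ij}(x)]_{n\times n}$, $B(x)=[b_{ij}(x)]_{n\times m}$ with entries continuous on $\mathbb{X}$; discrete-time system $x^{+}=A(x)x+B(x)u$, $x^{+}(k)=x(k+1)$, $k\in\mathbb{N}=\{0,1,2,\dots\}$. Assumption (A1): there are known functions $\xi_{A_j}:\mathbb{R}^n\to\mathbb{R}^{n_{A_j}}$ ($j=1,\dots,n$) and $\xi_{B_j}:\mathbb{R}^n\to\mathbb{R}^{n_{B_j}}$ ($j=1,\dots,m$), continuous on $\mathbb{X}$, and (unknown) constant matrices $E_{A_j}\in\mathbb{R}^{n\times n_{A_j}}$, $E_{B_j}\in\mathbb{R}^{n\times n_{B_j}}$ such that the $j$-th column of $A(x)$ equals $E_{A_j}\xi_{A_j}(x)$ and the $j$-th column of $B(x)$ equals $E_{B_j}\xi_{B_j}(x)$. Put $E_A=[E_{A_1}\cdots E_{A_n}]$, $E_B=[E_{B_1}\cdots E_{B_m}]$, $n_A=\sum_j n_{A_j}$, $n_B=\sum_j n_{B_j}$, $\Xi_A(x)=\mathrm{blkdiag}(\xi_{A_1}(x),\dots,\xi_{A_n}(x))$, $\Xi_B(x)=\mathrm{blkdiag}(\xi_{B_1}(x),\dots,\xi_{B_m}(x))$ (each $\xi$ a column vector block), so $A(x)=E_A\Xi_A(x)$, $B(x)=E_B\Xi_B(x)$. Data: for $k=0,\dots,T-1$ ($T\geq 1$), inputs $u_d(k)$, states $x_d(k)$ and noise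 $d(k)\in\mathbb{R}^n$ satisfy $x_d(k+1)=E_A\Xi_A(x_d(k))x_d(k)+E_B\Xi_B(x_d(k))u_d(k)+d(k)$. Data matrices: $X_0=[\Xi_A(x_d(0))x_d(0)\ \cdots\ \Xi_A(x_d(T-1))x_d(T-1)]$, $X_1=[x_d(1)\cdots x_d(T)]$, $U_0=[\Xi_B(x_d(0))u_d(0)\cdots\Xi_B(x_d(T-1))u_d(T-1)]$, $D_0=[d(0)\cdots d(T-1)]$, so $X_1=E_AX_0+E_BU_0+D_0$. Assumption (A2): a matrix $\Theta\succeq0$ is known with $D_0D_0^\top\preceq\Theta$. Assumption (A3): $\begin{bmatrix}X_0 \\ U_0\end{bmatrix}$ has full row rank. Define $\mathbf{A}=\begin{bmatrix}X_0 \\ U_0\end{bmatrix}\begin{bmatrix}X_0 \\ U_0\end{bmatrix}^\top$, $\mathbf{B}=-X_1\begin{bmatrix}X_0 \\ U_0\end{bmatrix}^\top$, $\mathbf{C}=X_1X_1^\top-\Theta$. Vertex set: let $\xi^A_{ij}$ and $\xi^B_{ij}$ be the $i$-th entries of $\xi_{A_j}$ and $\xi_{B_j}$, and let $\bar\xi^A_{ij},\underline\xi^A_{ij}$ (resp. $\bar\xi^B_{ij},\underline\xi^B_{ij}$) be the maximum and minimum of $\xi^A_{ij}$ (resp. $\xi^B_{ij}$) over $\mathcal{B}_r$. Then $\bar{\mathcal{Q}}$ is the finite set of all matrices $\mathrm{blkdiag}(\zeta_{A_1},\dots,\zeta_{A_n},\zeta_{B_1},\dots,\zeta_{B_m})\in\mathbb{R}^{(n_A+n_B)\times(n+m)}$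 where $\zeta_{A_j}\in\mathbb{R}^{n_{A_j}}$ has $i$-th entry in $\{\bar\xi^A_{ij},\underline\xi^A_{ij}\}$ and $\zeta_{B_j}\in\mathbb{R}^{n_{B_j}}$ has $i$-th entry in $\{\bar\xi^B_{ij},\underline\xi^B_{ij}\}$. Notation: $|\cdot|$ is the Euclidean norm; $\mathcal{B}_r=\{x\in\mathbb{R}^n:|x|\le r\}$; $\lambda_{\max},\lambda_{\min}$ are extreme eigenvalues of a symmetric matrix; $\succ,\succeq,\preceq$ denote the Loewner order. A set $\mathcal{R}\subset\mathbb{R}^n$ is a region of attraction of $x^{+}=f(x)$ relative to the equilibrium $0$ if for every $x(0)\in\mathcal{R}$ the solution satisfies $\lim_{k\to\infty}x(k)=0$. Exponential convergence to the origin from a set $\mathcal{R}$ means there are constants $c>0$, $\rho\in(0,1)$ such that $|x(k)|\le c\rho^k|x(0)|$ for all $k\in\mathbb{N}$ and all $x(0)\in\mathcal{R}$. These claims include that the solution remains in $\mathbb{X}$, so that it is defined for all $k$. *)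

theory Defs
  imports "HOL-Analysis.Analysis"
begin

text \<open>Concatenation. \<open>vcat\<close> stacks two vectors, or (since a matrix is a vector of rows) two
  matrices with the same column index type.\<close>

definition vcat :: "'x^'a \<Rightarrow> 'x^'b \<Rightarrow> 'x^('a + 'b)" where
  "vcat M N = (\<chi> s. case s of Inl i \<Rightarrow> M $ i | Inr i \<Rightarrow> N $ i)"

definition hcat :: "'x^'a^'r \<Rightarrow> 'x^'b^'r \<Rightarrow> 'x^('a + 'b)^'r" where
  "hcat M N = (\<chi> i. vcat (M $ i) (N $ i))"

text \<open>A family of column vectors $z_j \in R^{n_j}$, one for each \<open>j :: 'j\<close>, is represented by the
  single stacked vector \<open>z :: real^'p\<close>, where \<open>'p\<close> indexes all pairs $(i,j)$ with $i \le n_j$ and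
  \<open>blk :: 'p \<Rightarrow> 'j\<close> is the projection to $j$. Thus $n_j$ is the cardinality of
  \<open>{p. blk p = j}\<close>, the sum of the $n_j$ is \<open>CARD('p)\<close>, and the $n_j$ may differ from each other.
  \<open>blkdiag blk z\<close> is the block-diagonal matrix whose $j$-th diagonal block is the column $z_j$.
  A matrix $E = [E_1 \cdots E_k]$ with $E_j$ having $n_j$ columns is likewise a matrix with column
  index type \<open>'p\<close>, and \<open>blkcol blk E z j\<close> is the product $E_j z_j$.\<close>

definition blkdiag :: "('p \<Rightarrow> 'j) \<Rightarrow> real^'p \<Rightarrow> real^'j^'p" where
  "blkdiag blk z = (\<chi> p j. if blk p = j then z $ p else 0)"

definition blkcol :: "('p::finite \<Rightarrow> 'j) \<Rightarrow> real^'p^'n \<Rightarrow> real^'p \<Rightarrow> 'j \<Rightarrow> real^'n" where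
  "blkcol blk E z j = (\<Sum>p | blk p = j. z $ p *\<^sub>R column p E)"

text \<open>The matrix whose columns are \<open>f 0, \<dots>, f (T - 1)\<close>; the column index type \<open>'t\<close> is
  matched with the time instants by an enumeration \<open>\<tau>\<close> (a bijection onto \<open>{..<T}\<close>).\<close>

definition data_matrix :: "('t \<Rightarrow> nat) \<Rightarrow> (nat \<Rightarrow> real^'a) \<Rightarrow> real^'t^'a" where
  "data_matrix \<tau> f = (\<chi> i t. f (\<tau> t) $ i)"

definition pos_semidef :: "real^'a^'a \<Rightarrow> bool" where
  "pos_semidef M \<longleftrightarrow> transpose M = M \<and> (\<forall>v. 0 \<le> v \<bullet> (M *v v))"

definition pos_def :: "real^'a^'a \<Rightarrow> bool" where
  "pos_def M \<longleftrightarrow> transpose M = M \<and> (\<forall>v. v \<noteq> 0 \<longrightarrow> 0 < v \<bullet> (M *v v))"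

definition loewner_le :: "real^'a^'a \<Rightarrow> real^'a^'a \<Rightarrow> bool"  (infix "\<preceq>\<^sub>L" 50) where
  "M \<preceq>\<^sub>L N \<longleftrightarrow> pos_semidef (N - M)"

definition eigenvalues :: "real^'a^'a \<Rightarrow> real set" where
  "eigenvalues M = {l. \<exists>v. v \<noteq> 0 \<and> M *v v = l *\<^sub>R v}"

definition lambda_max :: "real^'a^'a \<Rightarrow> real" where
  "lambda_max M = Max (eigenvalues M)"

definition lambda_min :: "real^'a^'a \<Rightarrow> real" where
  "lambda_min M = Min (eigenvalues M)"

definition max_over :: "'x set \<Rightarrow> ('x \<Rightarrow> real) \<Rightarrow> real" where
  "max_over S f = (GREATEST y. y \<in> f ` S)"

definition min_over :: "'x set \<Rightarrow> ('x \<Rightarrow> real) \<Rightarrow> real" where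
  "min_over S f = (LEAST y. y \<in> f ` S)"

definition box_vertices :: "'x set \<Rightarrow> ('x \<Rightarrow> real^'p) \<Rightarrow> (real^'p) set" where
  "box_vertices S \<xi> =
     {\<zeta>. \<forall>p. \<zeta> $ p \<in> {max_over S (\<lambda>x. \<xi> x $ p), min_over S (\<lambda>x. \<xi> x $ p)}}"

definition vertex_set ::
  "real \<Rightarrow> ('p::finite \<Rightarrow> 'n::finite) \<Rightarrow> ('q::finite \<Rightarrow> 'm::finite) \<Rightarrow> (real^'n \<Rightarrow> real^'p) \<Rightarrow> (real^'n \<Rightarrow> real^'q)
     \<Rightarrow> (real^('n + 'm)^('p + 'q)) set" where
  "vertex_set r blkA blkB \<xi>A \<xi>B =
     {blkdiag (map_sum blkA blkB) (vcat \<zeta>A \<zeta>B) | \<zeta>A \<zeta>B.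
        \<zeta>A \<in> box_vertices (cball 0 r) \<xi>A \<and> \<zeta>B \<in> box_vertices (cball 0 r) \<xi>B}"

text \<open>The system $x^+ = f(x)$ lives on the state set \<open>X\<close>; values of \<open>f\<close> outside \<open>X\<close> carry no
  meaning, so both notions below require the solution to stay in \<open>X\<close>.\<close>

definition region_of_attraction :: "'a::real_normed_vector set \<Rightarrow> ('a \<Rightarrow> 'a) \<Rightarrow> 'a \<Rightarrow> 'a set \<Rightarrow> bool"
  where
  "region_of_attraction X f e R \<longleftrightarrow> e \<in> X \<and> f e = e \<and>
     (\<forall>x0\<in>R. (\<forall>k. (f ^^ k) x0 \<in> X) \<and> (\<lambda>k. (f ^^ k) x0) \<longlonglongrightarrow> e)"

definition exp_converges_to_origin :: "'a::real_normed_vector set \<Rightarrow> ('a \<Rightarrow> 'a) \<Rightarrow> 'a set \<Rightarrow> bool"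
  where
  "exp_converges_to_origin X f R \<longleftrightarrow>
     (\<exists>c \<rho>. 0 < c \<and> 0 < \<rho> \<and> \<rho> < 1 \<and>
        (\<forall>x0\<in>R. \<forall>k. (f ^^ k) x0 \<in> X \<and> norm ((f ^^ k) x0) \<le> c * \<rho> ^ k * norm x0))"

end

theory Submission
  imports Defs
begin

text \<open>The Lyapunov function is \<open>V x = x\<^sup>T \<Gamma>\<inverse> x\<close>. Evaluate the matrix inequality at the vector
  with blocks \<open>a\<close>, \<open>b = \<Gamma>\<inverse> x\<close> and \<open>c = - E\<^sup>T a\<close>, where \<open>E = [EA EB]\<close>: the data terms combine
  to the quadratic form of \<open>D0 D0\<^sup>T - \<Theta>\<close>, which is nonpositive, and the cross term is \<open>a\<^sup>T E Q [\<Gamma>; Y] b\<close>.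
  This term is linear in the entries of \<open>Q\<close>, so the vertices of the box control the value at the actual
  \<open>Q(x)\<close>, where it equals \<open>a\<^sup>T x\<^sup>+\<close>. With \<open>a = \<Gamma>\<inverse> x\<^sup>+\<close> this gives
  \<open>V x\<^sup>+ \<le> V x - \<epsilon> |\<Gamma>\<inverse> x|\<^sup>2\<close> for \<open>|x| \<le> r\<close>. The first step from the ball of radius \<open>r0\<close>
  lands in the sublevel set \<open>V \<le> r\<^sup>2 / \<lambda>_max(\<Gamma>)\<close>, which is invariant and contained in the ball of
  radius \<open>r\<close>.\<close>

subsection \<open>Block matrices\<close>

lemma sum_over_sum_type:
  fixes f :: "'a::finite + 'b::finite \<Rightarrow> 'c::comm_monoid_add"
  shows "(\<Sum>s\<in>UNIV. f s) = (\<Sum>a\<in>UNIV. f (Inl a)) + (\<Sum>b\<in>UNIV. f (Inr b))"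
  by (subst UNIV_Plus_UNIV[symmetric]) (simp add: sum.Plus del: UNIV_Plus_UNIV)

lemma inner_vcat: "vcat a b \<bullet> vcat c d = a \<bullet> c + b \<bullet> d"
  by (simp add: inner_vec_def sum_over_sum_type vcat_def)

lemma vcat_mult_vec: "vcat M N *v v = vcat (M *v v) (N *v v)"
  by (simp add: vec_eq_iff vcat_def matrix_vector_mult_def split: sum.split)

lemma hcat_mult_vcat: "hcat M N *v vcat a b = M *v a + N *v b"
  by (simp add: vec_eq_iff vcat_def hcat_def matrix_vector_mult_def sum_over_sum_type)

lemma uminus_mult_vec: "(- M) *v v = - (M *v (v::real^'a))"
  using matrix_vector_mult_diff_rdistrib[of 0 M v] by simp

lemma inner_transpose: "(transpose M *v x) \<bullet> y = x \<bullet> (M *v (y::real^'a))"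
  by (simp add: dot_lmul_matrix)

lemma mult_data_matrix: "M ** data_matrix \<tau> f = data_matrix \<tau> (\<lambda>k. M *v f k)"
  by (simp add: vec_eq_iff data_matrix_def matrix_matrix_mult_def matrix_vector_mult_def)

lemma hcat_mult_vcat_mat: "hcat M N ** vcat P R = M ** P + N ** R"
  by (simp add: vec_eq_iff vcat_def hcat_def matrix_matrix_mult_def sum_over_sum_type)

text \<open>Each row has at most one nonzero entry, so bilinear forms in such a matrix split into
  one term per entry of \<open>z\<close>; the vertex argument rests on this.\<close>

lemma blkdiag_mult_vec: "(blkdiag blk z *v v) $ p = z $ p * v $ blk p"
proof -
  have "(blkdiag blk z *v v) $ p = (\<Sum>j\<in>UNIV. if blk p = j then z $ p * v $ j else 0)"
    unfolding blkdiag_def matrix_vector_mult_def vec_lambda_beta by (rule sum.cong) auto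
  then show ?thesis by simp
qed

text \<open>Turns the column-wise form of (A1) into the factorisations of \<open>A x\<close> and
  \<open>B x\<close> through block-diagonal matrices.\<close>

lemma eq_mult_blkdiag:
  fixes E :: "real^'p^'n" and M :: "real^'j^'n" and blk :: "'p::finite \<Rightarrow> 'j"
  assumes "\<And>j. column j M = blkcol blk E z j"
  shows "M = E ** blkdiag blk z"
proof -
  have "M $ i $ j = (E ** blkdiag blk z) $ i $ j" for i j
  proof -
    have "M $ i $ j = blkcol blk E z j $ i"
      using assms[of j] by (simp add: column_def vec_eq_iff)
    also have "\<dots> = (\<Sum>p | blk p = j. E $ i $ p * z $ p)"
      by (simp add: blkcol_def column_def mult.commute)
    also have "\<dots> = (\<Sum>p\<in>UNIV. if blk p = j then E $ i $ p * z $ p else 0)"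
      by (rule sum.mono_neutral_cong_left) auto
    also have "\<dots> = (E ** blkdiag blk z) $ i $ j"
      unfolding matrix_matrix_mult_def blkdiag_def by (simp add: if_distrib cong: if_cong)
    finally show ?thesis .
  qed
  then show ?thesis by (simp add: vec_eq_iff)
qed

lemma blkdiag_map_sum_mult_vcat:
  fixes z1 :: "real^'p::finite" and z2 :: "real^'q::finite"
  shows "blkdiag (map_sum f g) (vcat z1 z2) *v vcat v w = vcat (blkdiag f z1 *v v) (blkdiag g z2 *v w)"
proof -
  have "(blkdiag (map_sum f g) (vcat z1 z2) *v vcat v w) $ s
      = vcat (blkdiag f z1 *v v) (blkdiag g z2 *v w) $ s" for s
    by (cases s) (simp_all add: blkdiag_mult_vec, simp_all add: vcat_def blkdiag_mult_vec)
  then show ?thesis by (simp add: vec_eq_iff)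
qed

subsection \<open>Extreme eigenvalues\<close>

text \<open>Otherwise a small step from \<open>v\<close> against \<open>u = M v\<close> would make
  the form negative: its first-order term is \<open>- 2 t |u|^2\<close>, and the remainder is
  quadratic in \<open>t\<close>.\<close>

lemma pos_semidef_kernel:
  assumes "pos_semidef M" and "v \<bullet> (M *v v) = 0"
  shows "M *v v = 0"
proof -
  define u where "u = M *v v"
  define q where "q = u \<bullet> (M *v u)"
  \<comment> \<open>The quadratic in \<open>t\<close> is smallest at \<open>|u|^2 / q\<close>; the
    \<open>+ 1\<close> covers \<open>q = 0\<close> and still ensures
    \<open>t * q \<le> |u|^2\<close>.\<close>
  define t where "t = (u \<bullet> u) / (q + 1)"
  have "q \<ge> 0" using assms(1) by (auto simp: q_def pos_semidef_def)
  have sym: "v \<bullet> (M *v u) = u \<bullet> u"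
    using assms(1) inner_transpose[of M v u] by (simp add: pos_semidef_def u_def)
  have "0 \<le> (v - t *\<^sub>R u) \<bullet> (M *v (v - t *\<^sub>R u))"
    using assms(1) by (simp add: pos_semidef_def)
  also have "\<dots> = - 2 * t * (u \<bullet> u) + t * t * q"
    using assms(2) sym
    by (simp add: matrix_vector_mult_diff_distrib matrix_vector_mult_scaleR inner_diff_left
        inner_diff_right u_def[symmetric] q_def algebra_simps)
  also have "\<dots> = t * (- 2 * (u \<bullet> u) + t * q)" by (simp add: algebra_simps)
  finally have le: "0 \<le> t * (- 2 * (u \<bullet> u) + t * q)" .
  have "t * q \<le> u \<bullet> u"
    using \<open>q \<ge> 0\<close> by (simp add: t_def field_simps)
  have "u = 0"
  proof (rule ccontr)
    assume "u \<noteq> 0"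
    then have "0 < u \<bullet> u" by simp
    then have "t > 0" unfolding t_def using \<open>q \<ge> 0\<close> by (intro divide_pos_pos) auto
    with le have "0 \<le> - 2 * (u \<bullet> u) + t * q" by (simp add: zero_le_mult_iff)
    with \<open>t * q \<le> u \<bullet> u\<close> \<open>0 < u \<bullet> u\<close> show False by linarith
  qed
  then show ?thesis by (simp add: u_def)
qed

text \<open>Eigenvectors of distinct eigenvalues are orthogonal, and a pairwise orthogonal set is
  finite. This gives \<open>Max\<close> and \<open>Min\<close> of the spectrum their
  meaning.\<close>

lemma finite_eigenvalues:
  assumes "transpose S = S"
  shows "finite (eigenvalues S)"
proof -
  define ev where "ev l = (SOME v. v \<noteq> 0 \<and> S *v v = l *\<^sub>R v)" for l
  have ev: "ev l \<noteq> 0 \<and> S *v ev l = l *\<^sub>R ev l" if "l \<in> eigenvalues S" for l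
    using that unfolding ev_def eigenvalues_def mem_Collect_eq by (rule someI_ex)
  have orth: "ev l \<bullet> ev k = 0" if "l \<in> eigenvalues S" "k \<in> eigenvalues S" "l \<noteq> k" for l k
  proof -
    have "(S *v ev l) \<bullet> ev k = ev l \<bullet> (S *v ev k)"
      using inner_transpose[of S "ev l" "ev k"] assms by simp
    then have "l * (ev l \<bullet> ev k) = k * (ev l \<bullet> ev k)"
      using ev[OF that(1)] ev[OF that(2)] by simp
    with that(3) show ?thesis by simp
  qed
  have inj: "inj_on ev (eigenvalues S)"
  proof (rule inj_onI, rule ccontr)
    fix l k assume *: "l \<in> eigenvalues S" "k \<in> eigenvalues S" "ev l = ev k" "l \<noteq> k"
    with orth[of l k] ev[of k] show False by simp
  qed
  have "pairwise orthogonal (ev ` eigenvalues S)"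
    using orth by (auto simp: pairwise_def orthogonal_def)
  then have "finite (ev ` eigenvalues S)" by (rule pairwise_orthogonal_imp_finite)
  with inj show ?thesis by (rule finite_imageD[rotated])
qed

text \<open>With \<open>l\<close> the maximum of the form on the unit sphere, \<open>l I - S\<close>
  is positive semidefinite and its form vanishes at the maximiser, which is therefore an
  eigenvector. This also shows that the spectrum is nonempty.\<close>

lemma rayleigh_attained:
  assumes "transpose S = S"
  obtains l where "l \<in> eigenvalues S" and "\<And>v. v \<bullet> (S *v v) \<le> l * (v \<bullet> v)"
proof -
  have "\<exists>v\<in>sphere 0 1. \<forall>w\<in>sphere 0 1. w \<bullet> (S *v w) \<le> v \<bullet> (S *v v)"
  proof (rule continuous_attains_sup)
    have "axis undefined 1 \<in> sphere (0::real^'a) 1" by simp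
    then show "sphere (0::real^'a) 1 \<noteq> {}" by blast
    show "continuous_on (sphere 0 1) (\<lambda>w. w \<bullet> (S *v w))"
      by (intro continuous_intros)
  qed simp
  then obtain v where v: "norm v = 1" and
    max: "\<And>w. norm w = 1 \<Longrightarrow> w \<bullet> (S *v w) \<le> v \<bullet> (S *v v)" by auto
  define l where "l = v \<bullet> (S *v v)"
  have bound: "w \<bullet> (S *v w) \<le> l * (w \<bullet> w)" for w
  proof (cases "w = 0")
    case False
    define u where "u = w /\<^sub>R norm w"
    have w: "w = norm w *\<^sub>R u" and "norm u = 1" using False by (simp_all add: u_def)
    have "(c *\<^sub>R u) \<bullet> (S *v (c *\<^sub>R u)) = c\<^sup>2 * (u \<bullet> (S *v u))" for c
      by (simp add: matrix_vector_mult_scaleR power2_eq_square)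
    from this[of "norm w"] have "w \<bullet> (S *v w) = (norm w)\<^sup>2 * (u \<bullet> (S *v u))"
      unfolding w[symmetric] .
    also have "\<dots> \<le> (norm w)\<^sup>2 * l"
      using max[OF \<open>norm u = 1\<close>] by (simp add: l_def mult_left_mono)
    finally show ?thesis by (simp add: power2_norm_eq_inner mult.commute)
  qed simp
  define M where "M = l *\<^sub>R mat 1 - S"
  have Mv: "M *v w = l *\<^sub>R w - S *v w" for w
    by (simp add: M_def matrix_vector_mult_diff_rdistrib scaleR_matrix_vector_assoc[symmetric])
  have "transpose M = M"
    using assms by (auto simp: M_def transpose_def vec_eq_iff mat_def)
  then have "pos_semidef M"
    using bound by (simp add: pos_semidef_def Mv inner_diff_right)
  moreover have "v \<bullet> (M *v v) = 0"
    using v by (simp add: Mv inner_diff_right l_def flip: power2_norm_eq_inner)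
  ultimately have "M *v v = 0" by (rule pos_semidef_kernel)
  then have "S *v v = l *\<^sub>R v" by (simp add: Mv)
  moreover have "v \<noteq> 0" using v by auto
  ultimately have "l \<in> eigenvalues S" by (auto simp: eigenvalues_def)
  with bound that show ?thesis by blast
qed

text \<open>Reduces the lower bound by \<open>lambda_min S\<close> to the upper bound for
  \<open>- S\<close>.\<close>

lemma eigenvalues_uminus: "eigenvalues (- S) = uminus ` eigenvalues S"
proof -
  have "l \<in> eigenvalues (- S) \<longleftrightarrow> - l \<in> eigenvalues S" for l
    by (simp add: eigenvalues_def uminus_mult_vec neg_eq_iff_add_eq_0 eq_neg_iff_add_eq_0)
  then show ?thesis by (force simp: image_iff)
qed

lemma lambda_max_mem:
  assumes "transpose S = S"
  shows "lambda_max S \<in> eigenvalues S"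
  unfolding lambda_max_def
  by (rule Max_in[OF finite_eigenvalues[OF assms]]) (rule rayleigh_attained[OF assms], blast)

lemma lambda_min_mem:
  assumes "transpose S = S"
  shows "lambda_min S \<in> eigenvalues S"
  unfolding lambda_min_def
  by (rule Min_in[OF finite_eigenvalues[OF assms]]) (rule rayleigh_attained[OF assms], blast)

lemma le_lambda_max:
  assumes "transpose S = S"
  shows "v \<bullet> (S *v v) \<le> lambda_max S * (v \<bullet> v)"
proof -
  obtain l where l: "l \<in> eigenvalues S" "\<And>v. v \<bullet> (S *v v) \<le> l * (v \<bullet> v)"
    using rayleigh_attained[OF assms] by blast
  have "l \<le> lambda_max S"
    unfolding lambda_max_def by (intro Max_ge finite_eigenvalues assms l)
  then show ?thesis using l(2)[of v] by (meson inner_ge_zero mult_right_mono order_trans)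
qed

lemma ge_lambda_min:
  assumes "transpose S = S"
  shows "lambda_min S * (v \<bullet> v) \<le> v \<bullet> (S *v v)"
proof -
  have "transpose (- S) = - S"
    using assms by (simp add: transpose_def vec_eq_iff)
  then obtain l where l: "l \<in> eigenvalues (- S)" "\<And>v. v \<bullet> (- S *v v) \<le> l * (v \<bullet> v)"
    using rayleigh_attained by blast
  then have "- l \<in> eigenvalues S" by (auto simp: eigenvalues_uminus)
  then have "lambda_min S \<le> - l"
    unfolding lambda_min_def by (intro Min_le finite_eigenvalues assms)
  then have "lambda_min S * (v \<bullet> v) \<le> - l * (v \<bullet> v)" by (rule mult_right_mono) simp
  then show ?thesis using l(2)[of v] by (simp add: uminus_mult_vec)
qed

lemma eigenvalue_pos:
  assumes "pos_def S" and "l \<in> eigenvalues S"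
  shows "0 < l"
proof -
  obtain v where "v \<noteq> 0" "S *v v = l *\<^sub>R v" using assms(2) by (auto simp: eigenvalues_def)
  then have "0 < l * (v \<bullet> v)" using assms(1) by (metis inner_scaleR_right pos_def_def)
  then show ?thesis using inner_ge_zero[of v] by (simp add: zero_less_mult_iff)
qed

text \<open>A positive definite matrix has trivial kernel, so the choice behind
  \<open>matrix_inv\<close> yields a genuine inverse.\<close>

lemma pos_def_mult_matrix_inv:
  assumes "pos_def S"
  shows "S *v (matrix_inv S *v x) = x"
proof -
  have "x = 0" if "S *v x = 0" for x
    using that assms by (metis inner_zero_right less_irrefl pos_def_def)
  then have "invertible S"
    by (simp add: invertible_left_inverse matrix_left_invertible_ker)
  then have "S ** matrix_inv S = mat 1"
    unfolding invertible_def matrix_inv_def by (rule someI2_ex) simp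
  then show ?thesis by (simp add: matrix_vector_mul_assoc)
qed

text \<open>Here \<open>y\<close> is the inverse of \<open>S\<close> applied to \<open>x\<close>;
  describing it by an equation avoids the spectrum of the inverse. The last two bounds come from
  Cauchy-Schwarz.\<close>

lemma inverse_form_bounds:
  assumes "pos_def S" and "S *v y = x"
  shows "(norm x)\<^sup>2 / lambda_max S \<le> x \<bullet> y"
    and "x \<bullet> y \<le> (norm x)\<^sup>2 / lambda_min S"
    and "norm x / lambda_max S \<le> norm y"
proof -
  have sym: "transpose S = S" using assms(1) by (simp add: pos_def_def)
  have M: "0 < lambda_max S" and m: "0 < lambda_min S"
    using assms(1) sym by (simp_all add: eigenvalue_pos lambda_max_mem lambda_min_mem)
  have psd: "0 \<le> v \<bullet> (S *v v)" for v
    using assms(1) by (cases "v = 0") (auto simp: pos_def_def less_imp_le)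
  \<comment> \<open>This \<open>a\<close> maximises
    \<open>2 (x \<bullet> a) - lambda_max S |a|^2\<close>, so the form of \<open>S\<close> at
    \<open>y - a\<close> gives the sharpest bound of this kind.\<close>
  define a where "a = x /\<^sub>R lambda_max S"
  have "y \<bullet> (S *v a) = x \<bullet> a"
    using inner_transpose[of S y a] sym assms(2) by simp
  then have "0 \<le> x \<bullet> y - 2 * (x \<bullet> a) + a \<bullet> (S *v a)"
    using psd[of "y - a"] assms(2)
    by (simp add: matrix_vector_mult_diff_distrib inner_diff_left inner_diff_right inner_commute)
  also have "\<dots> \<le> x \<bullet> y - 2 * (x \<bullet> a) + lambda_max S * (a \<bullet> a)"
    using le_lambda_max[OF sym, of a] by simp
  also have "\<dots> = x \<bullet> y - (norm x)\<^sup>2 / lambda_max S"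
    using M by (simp add: a_def power2_norm_eq_inner field_simps)
  finally show low: "(norm x)\<^sup>2 / lambda_max S \<le> x \<bullet> y" by simp
  have cs: "x \<bullet> y \<le> norm x * norm y" by (rule norm_cauchy_schwarz)
  have "lambda_min S * (norm y * norm y) \<le> x \<bullet> y"
    using ge_lambda_min[OF sym, of y] assms(2)
    by (simp add: inner_commute power2_norm_eq_inner[symmetric] power2_eq_square)
  also note cs
  finally have "lambda_min S * norm y \<le> norm x"
    by (cases "y = 0") (auto simp: mult.assoc[symmetric])
  then have "norm y \<le> norm x / lambda_min S" using m by (simp add: field_simps)
  then have "norm x * norm y \<le> norm x * (norm x / lambda_min S)" by (rule mult_left_mono) simp
  with cs show "x \<bullet> y \<le> (norm x)\<^sup>2 / lambda_min S" by (simp add: power2_eq_square)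
  have "norm x * (norm x / lambda_max S) \<le> norm x * norm y"
    using low cs by (simp add: power2_eq_square)
  then show "norm x / lambda_max S \<le> norm y"
    by (cases "x = 0") (auto simp: mult_le_cancel_left simp flip: times_divide_eq_right)
qed

subsection \<open>Maximising over the vertices\<close>

text \<open>Compactness and continuity make the supremum attained, so that \<open>GREATEST\<close>
  denotes it.\<close>

lemma max_over_ge:
  assumes "compact S" and "continuous_on S f" and "x \<in> S"
  shows "f x \<le> max_over S f"
proof -
  obtain z where z: "z \<in> S" "\<And>y. y \<in> S \<Longrightarrow> f y \<le> f z"
    using continuous_attains_sup[of S f] assms by blast
  then have "max_over S f = f z"
    unfolding max_over_def by (intro Greatest_equality) auto
  with z assms(3) show ?thesis by simp
qed

lemma min_over_le:
  assumes "compact S" and "continuous_on S f" and "x \<in> S"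
  shows "min_over S f \<le> f x"
proof -
  obtain z where z: "z \<in> S" "\<And>y. y \<in> S \<Longrightarrow> f z \<le> f y"
    using continuous_attains_inf[of S f] assms by blast
  then have "min_over S f = f z"
    unfolding min_over_def by (intro Least_equality) auto
  with z assms(3) show ?thesis by simp
qed

text \<open>The entries of a vertex are chosen independently, so the sign of each \<open>g p\<close>
  decides between maximum and minimum.\<close>

lemma box_vertices_dominate:
  assumes "compact S" and "continuous_on S \<xi>" and "x \<in> S"
  obtains \<zeta> where "\<zeta> \<in> box_vertices S \<xi>" and "\<And>p. g p * \<xi> x $ p \<le> g p * \<zeta> $ p"
proof
  let ?\<zeta> = "\<chi> p. if 0 \<le> g p then max_over S (\<lambda>x. \<xi> x $ p) else min_over S (\<lambda>x. \<xi> x $ p)"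
  show "?\<zeta> \<in> box_vertices S \<xi>" by (simp add: box_vertices_def)
  have "continuous_on S (\<lambda>x. \<xi> x $ p)" for p
    using assms(2) by (intro continuous_intros)
  then show "g p * \<xi> x $ p \<le> g p * ?\<zeta> $ p" for p
    using max_over_ge[OF assms(1) _ assms(3)] min_over_le[OF assms(1) _ assms(3)]
    by (cases "0 \<le> g p") (auto intro: mult_left_mono mult_left_mono_neg)
qed

text \<open>The form is linear in the block vector, so each entry can be pushed separately to the
  endpoint selected by the sign of its coefficient.\<close>

lemma vertex_dominates:
  fixes blkA :: "'p::finite \<Rightarrow> 'n::finite" and blkB :: "'q::finite \<Rightarrow> 'm::finite"
  assumes "continuous_on (cball 0 r) \<xi>A" and "continuous_on (cball 0 r) \<xi>B" and "x \<in> cball 0 r"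
  obtains Q where "Q \<in> vertex_set r blkA blkB \<xi>A \<xi>B"
    and "vcat c1 c2 \<bullet> (Q *v vcat v1 v2)
         \<le> c1 \<bullet> (blkdiag blkA (\<xi>A x) *v v1) + c2 \<bullet> (blkdiag blkB (\<xi>B x) *v v2)"
proof -
  \<comment> \<open>The vertex has to minimise the form, whereas
    \<open>box_vertices_dominate\<close> maximises; hence the negated coefficients.\<close>
  obtain \<zeta>A where A: "\<zeta>A \<in> box_vertices (cball 0 r) \<xi>A"
      "\<And>p. - (c1 $ p * v1 $ blkA p) * \<xi>A x $ p \<le> - (c1 $ p * v1 $ blkA p) * \<zeta>A $ p"
    using box_vertices_dominate[OF compact_cball assms(1,3),
        where g = "\<lambda>p. - (c1 $ p * v1 $ blkA p)"] by blast
  obtain \<zeta>B where B: "\<zeta>B \<in> box_vertices (cball 0 r) \<xi>B"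
      "\<And>p. - (c2 $ p * v2 $ blkB p) * \<xi>B x $ p \<le> - (c2 $ p * v2 $ blkB p) * \<zeta>B $ p"
    using box_vertices_dominate[OF compact_cball assms(2,3),
        where g = "\<lambda>p. - (c2 $ p * v2 $ blkB p)"] by blast
  let ?Q = "blkdiag (map_sum blkA blkB) (vcat \<zeta>A \<zeta>B)"
  have "c1 \<bullet> (blkdiag blkA \<zeta>A *v v1) \<le> c1 \<bullet> (blkdiag blkA (\<xi>A x) *v v1)"
    unfolding inner_vec_def blkdiag_mult_vec
    by (rule sum_mono) (use A(2) in \<open>simp add: ac_simps\<close>)
  moreover have "c2 \<bullet> (blkdiag blkB \<zeta>B *v v2) \<le> c2 \<bullet> (blkdiag blkB (\<xi>B x) *v v2)"
    unfolding inner_vec_def blkdiag_mult_vec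
    by (rule sum_mono) (use B(2) in \<open>simp add: ac_simps\<close>)
  ultimately have "vcat c1 c2 \<bullet> (?Q *v vcat v1 v2)
      \<le> c1 \<bullet> (blkdiag blkA (\<xi>A x) *v v1) + c2 \<bullet> (blkdiag blkB (\<xi>B x) *v v2)"
    by (simp add: blkdiag_map_sum_mult_vcat inner_vcat)
  moreover have "?Q \<in> vertex_set r blkA blkB \<xi>A \<xi>B"
    using A(1) B(1) by (auto simp: vertex_set_def)
  ultimately show ?thesis using that by blast
qed

subsection \<open>The quadratic forms of the data and of the matrix inequality\<close>

text \<open>Testing the matrix inequality at the stacked vector \<open>(a, b, c)\<close> leaves a
  scalar inequality; off-diagonal blocks occur in transposed pairs, hence the factors 2.\<close>

lemma lmi_quadratic_form:
  fixes \<Gamma> CC :: "real^'n^'n" and BB :: "real^'s^'n" and Q :: "real^('n + 'm::finite)^'s" and Y :: "real^'n^'m"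
  assumes "vcat (hcat (- \<Gamma> - CC) (hcat 0 BB))
          (vcat (hcat 0 (hcat (- \<Gamma> + \<epsilon> *\<^sub>R mat 1) (- (transpose (vcat \<Gamma> Y) ** transpose Q))))
                (hcat (transpose BB) (hcat (- (Q ** vcat \<Gamma> Y)) (- AA)))) \<preceq>\<^sub>L 0"
  shows "2 * (a \<bullet> (BB *v c)) - 2 * (c \<bullet> (Q *v vcat (\<Gamma> *v b) (Y *v b))) + \<epsilon> * (b \<bullet> b)
      \<le> a \<bullet> (\<Gamma> *v a) + a \<bullet> (CC *v a) + b \<bullet> (\<Gamma> *v b) + c \<bullet> (AA *v c)"
proof -
  have off: "b \<bullet> ((transpose (vcat \<Gamma> Y) ** transpose Q) *v c) = c \<bullet> (Q *v vcat (\<Gamma> *v b) (Y *v b))"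
    by (metis inner_commute inner_transpose matrix_transpose_mul matrix_vector_mul_assoc vcat_mult_vec)
  have sym: "c \<bullet> (transpose BB *v a) = a \<bullet> (BB *v c)"
    using inner_transpose[of BB a c] by (simp add: inner_commute del: transpose_matrix_vector)
  have "0 \<le> vcat a (vcat b c) \<bullet> (- (vcat (hcat (- \<Gamma> - CC) (hcat 0 BB))
          (vcat (hcat 0 (hcat (- \<Gamma> + \<epsilon> *\<^sub>R mat 1) (- (transpose (vcat \<Gamma> Y) ** transpose Q))))
                (hcat (transpose BB) (hcat (- (Q ** vcat \<Gamma> Y)) (- AA))))) *v vcat a (vcat b c))"
    using assms by (simp add: loewner_le_def pos_semidef_def)
  also have "\<dots> = - (a \<bullet> (- (\<Gamma> *v a) - CC *v a + BB *v c)
      + (b \<bullet> (- (\<Gamma> *v b) + \<epsilon> *\<^sub>R b - (transpose (vcat \<Gamma> Y) ** transpose Q) *v c)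
      + c \<bullet> (transpose BB *v a + (- (Q *v vcat (\<Gamma> *v b) (Y *v b)) - AA *v c))))"
    by (simp add: uminus_mult_vec vcat_mult_vec hcat_mult_vcat inner_vcat
        matrix_vector_mult_diff_rdistrib matrix_vector_mult_add_rdistrib
        scaleR_matrix_vector_assoc[symmetric] matrix_vector_mul_assoc[symmetric]
        del: transpose_matrix_vector)
  finally show ?thesis
    by (simp add: inner_add_right inner_diff_right off sym del: transpose_matrix_vector)
qed

text \<open>With \<open>c = - E\<^sup>T a\<close> the left-hand side is the form of \<open>D0 D0\<^sup>T - \<Theta>\<close> at \<open>a\<close>.\<close>

lemma data_quadratic_form:
  fixes E :: "real^'s^'n" and Z :: "real^'t^'s" and D0 X1 :: "real^'t^'n"
  assumes "X1 = E ** Z + D0" and "D0 ** transpose D0 \<preceq>\<^sub>L \<Theta>" and "c = - (transpose E *v a)"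
  shows "a \<bullet> ((X1 ** transpose X1 - \<Theta>) *v a) + c \<bullet> ((Z ** transpose Z) *v c)
      - 2 * (a \<bullet> (- (X1 ** transpose Z) *v c)) \<le> 0"
proof -
  \<comment> \<open>Since \<open>D0 = X1 - E Z\<close>, these choices give
    \<open>D0^T a = z - w\<close>, and the claimed expression is
    \<open>|z - w|^2 - a \<bullet> (\<Theta> *v a)\<close>.\<close>
  define z where "z = transpose X1 *v a"
  define w where "w = - (transpose Z *v c)"
  have form: "u \<bullet> ((M ** transpose N) *v v) = (transpose M *v u) \<bullet> (transpose N *v v)"
    for M :: "real^'t^'k" and N :: "real^'t^'l" and u v
    by (metis inner_transpose matrix_vector_mul_assoc)
  have w: "w = transpose Z *v (transpose E *v a)"
    unfolding w_def assms(3) using matrix_vector_mult_diff_distrib[of "transpose Z" 0] by simp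
  have "transpose X1 = transpose Z ** transpose E + transpose D0"
    unfolding assms(1) matrix_transpose_mul[symmetric] by (simp add: transpose_def vec_eq_iff)
  then have zw: "transpose D0 *v a = z - w"
    unfolding w z_def matrix_vector_mul_assoc by (simp add: matrix_vector_mult_add_rdistrib)
  have "0 \<le> a \<bullet> ((\<Theta> - D0 ** transpose D0) *v a)"
    using assms(2) by (simp add: loewner_le_def pos_semidef_def)
  also have "\<dots> = a \<bullet> (\<Theta> *v a) - (z - w) \<bullet> (z - w)"
    unfolding matrix_vector_mult_diff_rdistrib inner_diff_right[of a] form zw ..
  finally have "(z - w) \<bullet> (z - w) \<le> a \<bullet> (\<Theta> *v a)" by simp
  moreover have "transpose Z *v c = - w" by (simp add: w_def)
  ultimately show ?thesis
    unfolding matrix_vector_mult_diff_rdistrib inner_diff_right[of a] uminus_mult_vec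
      inner_minus_right form z_def[symmetric]
    by (simp add: inner_diff_left inner_diff_right inner_commute del: transpose_matrix_vector)
qed

subsection \<open>From a decreasing quadratic form to exponential convergence\<close>

text \<open>The sublevel set \<open>V \<le> r\<^sup>2 / M\<close> lies in the ball of radius \<open>r\<close> and is entered after one step;
  this one-step gain is what makes the admissible initial ball larger than the largest ball
  contained in the sublevel set.\<close>

lemma quadratic_decrease_imp_exp_decay:
  fixes f :: "'a::real_normed_vector \<Rightarrow> 'a" and V :: "'a \<Rightarrow> real"
  assumes m: "0 < m" and M: "0 < M" and "0 < \<epsilon>" and "0 < r"
    and low: "\<And>x. (norm x)\<^sup>2 / M \<le> V x" and up: "\<And>x. V x \<le> (norm x)\<^sup>2 / m"
    and decr: "\<And>x. norm x \<le> r \<Longrightarrow> V (f x) \<le> V x - \<epsilon> * (norm x / M)\<^sup>2"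
    and R: "\<And>x. x \<in> R \<Longrightarrow> norm x \<le> r \<and> (norm x)\<^sup>2 * (M\<^sup>2 - \<epsilon> * m) \<le> M * m * r\<^sup>2"
  obtains c \<rho> where "0 < c" "0 < \<rho>" "\<rho> < 1"
    and "\<And>x k. x \<in> R \<Longrightarrow> norm ((f ^^ k) x) \<le> r \<and> norm ((f ^^ k) x) \<le> c * \<rho> ^ k * norm x"
proof -
  \<comment> \<open>The upper bound on \<open>V\<close> turns the decrease into the factor
    \<open>1 - \<epsilon> m / M^2\<close>; the maximum with 1/2 keeps \<open>q\<close> positive, so
    that \<open>sqrt q\<close> can serve as the rate.\<close>
  define q where "q = max (1 / 2) (1 - \<epsilon> * m / M\<^sup>2)"
  have q: "0 < q" "q < 1" using m M \<open>0 < \<epsilon>\<close> by (auto simp: q_def less_max_iff_disj)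
  have V0: "0 \<le> V x" for x
    using low[of x] M by (meson divide_nonneg_pos order_trans zero_le_power2)
  have contract: "V (f x) \<le> q * V x" if "norm x \<le> r" for x
  proof -
    have "m * V x \<le> (norm x)\<^sup>2" using up[of x] m by (simp add: field_simps)
    then have "\<epsilon> / M\<^sup>2 * (m * V x) \<le> \<epsilon> / M\<^sup>2 * (norm x)\<^sup>2"
      using \<open>0 < \<epsilon>\<close> by (intro mult_left_mono) auto
    then have "V (f x) \<le> (1 - \<epsilon> * m / M\<^sup>2) * V x"
      using decr[OF that] by (simp add: power_divide algebra_simps)
    also have "\<dots> \<le> q * V x" by (rule mult_right_mono) (simp_all add: q_def V0)
    finally show ?thesis .
  qed
  \<comment> \<open>The second condition on \<open>R\<close> is exactly
    \<open>(1/m - \<epsilon>/M^2) |x|^2 \<le> r^2 / M\<close>.\<close>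
  have first: "V (f x) \<le> r\<^sup>2 / M" if "x \<in> R" for x
  proof -
    have "V (f x) \<le> (norm x)\<^sup>2 / m - \<epsilon> * (norm x / M)\<^sup>2"
      using decr[of x] up[of x] R[OF that] by simp
    also have "\<dots> = (norm x)\<^sup>2 * (M\<^sup>2 - \<epsilon> * m) / (m * M\<^sup>2)"
      using m M by (simp add: field_simps power2_eq_square)
    also have "\<dots> \<le> M * m * r\<^sup>2 / (m * M\<^sup>2)"
      using R[OF that] m M by (intro divide_right_mono) auto
    also have "\<dots> = r\<^sup>2 / M" using m M by (simp add: power2_eq_square)
    finally show ?thesis .
  qed
  have ball: "norm x \<le> r" if "V x \<le> r\<^sup>2 / M" for x
  proof -
    have "(norm x)\<^sup>2 / M \<le> r\<^sup>2 / M" using low[of x] that by simp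
    then have "(norm x)\<^sup>2 \<le> r\<^sup>2" using M by (simp add: divide_le_cancel)
    then show ?thesis using \<open>0 < r\<close> by (simp add: abs_le_square_iff[symmetric])
  qed
  \<comment> \<open>The index starts at \<open>Suc k\<close> because the initial point itself may
    lie outside the sublevel set.\<close>
  have inv: "V ((f ^^ Suc k) x) \<le> r\<^sup>2 / M" if "x \<in> R" for x k
  proof (induction k)
    case 0
    then show ?case using first[OF that] by simp
  next
    case (Suc k)
    let ?y = "(f ^^ Suc k) x"
    have "V (f ?y) \<le> q * V ?y" by (rule contract[OF ball[OF Suc]])
    also have "\<dots> \<le> 1 * V ?y" by (rule mult_right_mono) (use q V0 in auto)
    finally show ?case using Suc by simp
  qed
  have stay: "norm ((f ^^ k) x) \<le> r" if "x \<in> R" for x k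
    using R[OF that] ball[OF inv[OF that]] by (cases k) auto
  have decay: "V ((f ^^ k) x) \<le> q ^ k * V x" if "x \<in> R" for x k
  proof (induction k)
    case (Suc k)
    have "V ((f ^^ Suc k) x) \<le> q * V ((f ^^ k) x)"
      using contract[OF stay[OF that]] by simp
    also have "\<dots> \<le> q * (q ^ k * V x)" using Suc q by (intro mult_left_mono) auto
    finally show ?case by (simp add: mult.assoc)
  qed simp
  \<comment> \<open>Using \<open>low\<close> at time \<open>k\<close> and \<open>up\<close> at time
    0 costs the factor \<open>M / m\<close> for squared norms, whence the square roots.\<close>
  have "norm ((f ^^ k) x) \<le> sqrt (M / m) * sqrt q ^ k * norm x" if "x \<in> R" for x k
  proof (rule power2_le_imp_le)
    have "(norm ((f ^^ k) x))\<^sup>2 \<le> M * V ((f ^^ k) x)"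
      using low[of "(f ^^ k) x"] M by (simp add: field_simps)
    also have "\<dots> \<le> M * (q ^ k * ((norm x)\<^sup>2 / m))"
      using decay[OF that, of k] mult_left_mono[OF up[of x], of "q ^ k"] q M
      by (intro mult_left_mono) auto
    also have "\<dots> = (sqrt (M / m) * sqrt q ^ k * norm x)\<^sup>2"
      using q m M by (simp add: power_mult_distrib power_mult[symmetric] mult.commute[of k])
        (simp add: power_mult)
    finally show "(norm ((f ^^ k) x))\<^sup>2 \<le> (sqrt (M / m) * sqrt q ^ k * norm x)\<^sup>2" .
    show "0 \<le> sqrt (M / m) * sqrt q ^ k * norm x" using q m M by simp
  qed
  with stay q m M show ?thesis by (intro that[of "sqrt (M / m)" "sqrt q"]) auto
qed

lemma exp_decay_imp_attraction:
  fixes f :: "'a::real_normed_vector \<Rightarrow> 'a"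
  assumes "0 \<in> X" and "f 0 = 0" and "exp_converges_to_origin X f R"
  shows "region_of_attraction X f 0 R"
proof -
  obtain c \<rho> where c: "0 < \<rho>" "\<rho> < 1"
    and k: "\<And>x k. x \<in> R \<Longrightarrow> (f ^^ k) x \<in> X \<and> norm ((f ^^ k) x) \<le> c * \<rho> ^ k * norm x"
    using assms(3) unfolding exp_converges_to_origin_def by blast
  have "(\<lambda>k. (f ^^ k) x) \<longlonglongrightarrow> 0" if "x \<in> R" for x
  proof (rule Lim_null_comparison)
    show "\<forall>\<^sub>F k in sequentially. norm ((f ^^ k) x) \<le> c * \<rho> ^ k * norm x" using k[OF that] by simp
    have "(\<lambda>k. c * \<rho> ^ k * norm x) \<longlonglongrightarrow> c * 0 * norm x"
      using c by (intro tendsto_intros LIMSEQ_realpow_zero) auto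
    then show "(\<lambda>k. c * \<rho> ^ k * norm x) \<longlonglongrightarrow> 0" by simp
  qed
  with assms(1,2) k show ?thesis by (auto simp: region_of_attraction_def)
qed

section \<open>Stability of the closed loop\<close>

theorem theorem4:
  fixes X :: "(real^'n) set"
    and A :: "real^'n \<Rightarrow> real^'n^'n" and B :: "real^'n \<Rightarrow> real^'m^'n"
    and blkA :: "'p::finite \<Rightarrow> 'n" and blkB :: "'q::finite \<Rightarrow> 'm"
    and \<xi>A :: "real^'n \<Rightarrow> real^'p" and \<xi>B :: "real^'n \<Rightarrow> real^'q"
    and EA :: "real^'p^'n" and EB :: "real^'q^'n"
    and T :: nat and \<tau> :: "'t::finite \<Rightarrow> nat"
    and ud :: "nat \<Rightarrow> real^'m" and xd :: "nat \<Rightarrow> real^'n" and d :: "nat \<Rightarrow> real^'n"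
    and X0 :: "real^'t^'p" and U0 :: "real^'t^'q" and X1 D0 :: "real^'t^'n"
    and \<Theta> :: "real^'n^'n"
    and AA :: "real^('p + 'q)^('p + 'q)" and BB :: "real^('p + 'q)^'n" and CC :: "real^'n^'n"
    and r :: real and \<Gamma> :: "real^'n^'n" and \<epsilon> :: real and Y K :: "real^'n^'m" and r0 :: real
  assumes "0 \<in> X"
    and "\<And>i j. continuous_on X (\<lambda>x. A x $ i $ j)"
    and "\<And>i j. continuous_on X (\<lambda>x. B x $ i $ j)"
    \<comment> \<open>(A1)\<close>
    and "continuous_on X \<xi>A" and "continuous_on X \<xi>B"
    and "\<And>x j. x \<in> X \<Longrightarrow> column j (A x) = blkcol blkA EA (\<xi>A x) j"
    and "\<And>x j. x \<in> X \<Longrightarrow> column j (B x) = blkcol blkB EB (\<xi>B x) j"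
    \<comment> \<open>data\<close>
    and "1 \<le> T" and "bij_betw \<tau> UNIV {..<T}"
    and "\<And>k. k < T \<Longrightarrow>
           xd (k + 1) = EA *v (blkdiag blkA (\<xi>A (xd k)) *v xd k)
                      + EB *v (blkdiag blkB (\<xi>B (xd k)) *v ud k) + d k"
    and "X0 = data_matrix \<tau> (\<lambda>k. blkdiag blkA (\<xi>A (xd k)) *v xd k)"
    and "X1 = data_matrix \<tau> (\<lambda>k. xd (k + 1))"
    and "U0 = data_matrix \<tau> (\<lambda>k. blkdiag blkB (\<xi>B (xd k)) *v ud k)"
    and "D0 = data_matrix \<tau> d"
    \<comment> \<open>(A2)\<close>
    and "pos_semidef \<Theta>" and "D0 ** transpose D0 \<preceq>\<^sub>L \<Theta>"
    \<comment> \<open>(A3)\<close>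
    and "rank (vcat X0 U0) = CARD('p + 'q)"
    and "AA = vcat X0 U0 ** transpose (vcat X0 U0)"
    and "BB = - (X1 ** transpose (vcat X0 U0))"
    and "CC = X1 ** transpose X1 - \<Theta>"
    and "0 < r" and "cball 0 r \<subseteq> X"
    and "pos_def \<Gamma>" and "0 < \<epsilon>"
    and "\<And>Q. Q \<in> vertex_set r blkA blkB \<xi>A \<xi>B \<Longrightarrow>
           vcat (hcat (- \<Gamma> - CC) (hcat 0 BB))
          (vcat (hcat 0 (hcat (- \<Gamma> + \<epsilon> *\<^sub>R mat 1) (- (transpose (vcat \<Gamma> Y) ** transpose Q))))
                (hcat (transpose BB) (hcat (- (Q ** vcat \<Gamma> Y)) (- AA)))) \<preceq>\<^sub>L 0"
    and "K = Y ** matrix_inv \<Gamma>"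
    and "r0 = (let den = (lambda_max \<Gamma>)\<^sup>2 - \<epsilon> * lambda_min \<Gamma> in
               if den = 0 then r
               else min r (sqrt (lambda_max \<Gamma> * lambda_min \<Gamma> / den) * r))"
  shows "region_of_attraction X (\<lambda>x. (A x + B x ** K) *v x) 0 (cball 0 r0) \<and>
         exp_converges_to_origin X (\<lambda>x. (A x + B x ** K) *v x) (cball 0 r0)"
proof -
  let ?f = "\<lambda>x. (A x + B x ** K) *v x"
  define P where "P = matrix_inv \<Gamma>"
  define V where "V x = x \<bullet> (P *v x)" for x
  have \<Gamma>P: "\<Gamma> *v (P *v x) = x" for x
    unfolding P_def by (rule pos_def_mult_matrix_inv[OF assms(23)])
  have sym: "transpose \<Gamma> = \<Gamma>" using assms(23) by (simp add: pos_def_def)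
  have M: "0 < lambda_max \<Gamma>" and m: "0 < lambda_min \<Gamma>"
    using assms(23) sym by (simp_all add: eigenvalue_pos lambda_max_mem lambda_min_mem)
  note bounds = inverse_form_bounds[OF assms(23) \<Gamma>P]
  define E where "E = hcat EA EB"
  have X1: "X1 = E ** vcat X0 U0 + D0"
  proof -
    \<comment> \<open>The recorded dynamics hold only before time \<open>T\<close>, so the
      enumeration must be seen to stay below \<open>T\<close>.\<close>
    have "\<tau> t < T" for t using assms(9) by (auto simp: bij_betw_def)
    from assms(10)[OF this] show ?thesis
      unfolding E_def hcat_mult_vcat_mat assms(11-14) mult_data_matrix
      by (simp add: data_matrix_def vec_eq_iff)
  qed
  have decr: "V (?f x) \<le> V x - \<epsilon> * (norm x / lambda_max \<Gamma>)\<^sup>2" if "norm x \<le> r" for x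
  proof -
    define w where "w = ?f x"
    define a where "a = P *v w"
    define b where "b = P *v x"
    have x: "x \<in> cball 0 r" using that by simp
    then have "x \<in> X" using assms(22) by blast
    have Ax: "A x = EA ** blkdiag blkA (\<xi>A x)"
      using assms(6)[OF \<open>x \<in> X\<close>] by (rule eq_mult_blkdiag)
    have Bx: "B x = EB ** blkdiag blkB (\<xi>B x)"
      using assms(7)[OF \<open>x \<in> X\<close>] by (rule eq_mult_blkdiag)
    have Yb: "Y *v b = K *v x"
      by (simp add: assms(26) b_def P_def matrix_vector_mul_assoc)
    have \<Gamma>b: "\<Gamma> *v b = x" and \<Gamma>a: "\<Gamma> *v a = w" by (simp_all add: a_def b_def \<Gamma>P)
    define c1 where "c1 = - (transpose EA *v a)"
    define c2 where "c2 = - (transpose EB *v a)"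
    have c: "vcat c1 c2 = - (transpose E *v a)"
    proof -
      have "transpose E = vcat (transpose EA) (transpose EB)"
        by (simp add: E_def vec_eq_iff transpose_def hcat_def vcat_def split: sum.split)
      then show ?thesis
        by (simp add: vcat_mult_vec c1_def c2_def del: transpose_matrix_vector)
          (simp add: vcat_def vec_eq_iff split: sum.split)
    qed
    \<comment> \<open>The vertex depends on \<open>x\<close> and \<open>a\<close>; the matrix
      inequality is used only at this vertex.\<close>
    obtain Q where Q: "Q \<in> vertex_set r blkA blkB \<xi>A \<xi>B"
      and le: "vcat c1 c2 \<bullet> (Q *v vcat x (K *v x))
        \<le> c1 \<bullet> (blkdiag blkA (\<xi>A x) *v x) + c2 \<bullet> (blkdiag blkB (\<xi>B x) *v (K *v x))"
      using vertex_dominates[OF _ _ x, of \<xi>A \<xi>B] assms(4,5,22) continuous_on_subset by metis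
    \<comment> \<open>At the actual block values, \<open>E\<close> times the block-diagonal matrix
      times \<open>(x, K x)\<close> is the successor state \<open>w\<close>.\<close>
    have "c1 \<bullet> (blkdiag blkA (\<xi>A x) *v x) + c2 \<bullet> (blkdiag blkB (\<xi>B x) *v (K *v x)) = - (a \<bullet> w)"
      unfolding c1_def c2_def inner_minus_left inner_transpose w_def Ax Bx
      by (simp add: matrix_vector_mult_add_rdistrib inner_add_right matrix_vector_mul_assoc
            matrix_mul_assoc)
    with le have cQ: "vcat c1 c2 \<bullet> (Q *v vcat (\<Gamma> *v b) (Y *v b)) \<le> - (a \<bullet> w)"
      by (simp add: \<Gamma>b Yb)
    have "a \<bullet> (CC *v a) + vcat c1 c2 \<bullet> (AA *v vcat c1 c2) - 2 * (a \<bullet> (BB *v vcat c1 c2)) \<le> 0"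
      unfolding assms(18-20) by (rule data_quadratic_form[OF X1 assms(16) c])
    \<comment> \<open>The terms in \<open>CC\<close>, \<open>AA\<close> and \<open>BB\<close> drop
      out by the data inequality, and \<open>\<Gamma> a = w\<close>, \<open>\<Gamma> b = x\<close>
      simplify the rest; one copy of \<open>a \<bullet> w\<close> then cancels.\<close>
    with lmi_quadratic_form[OF assms(25)[OF Q], of a "vcat c1 c2" b] cQ
    have "2 * (a \<bullet> w) + \<epsilon> * (b \<bullet> b) \<le> a \<bullet> w + b \<bullet> x"
      by (simp add: \<Gamma>a \<Gamma>b)
    then have "V w \<le> V x - \<epsilon> * (norm b)\<^sup>2"
      by (simp add: V_def a_def b_def inner_commute power2_norm_eq_inner)
    also have "\<dots> \<le> V x - \<epsilon> * (norm x / lambda_max \<Gamma>)\<^sup>2"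
      using bounds(3)[of x] M assms(24)
      by (auto simp: b_def intro!: mult_left_mono power_mono)
    finally show ?thesis by (simp add: w_def)
  qed
  have R: "norm x \<le> r \<and>
      (norm x)\<^sup>2 * ((lambda_max \<Gamma>)\<^sup>2 - \<epsilon> * lambda_min \<Gamma>) \<le> lambda_max \<Gamma> * lambda_min \<Gamma> * r\<^sup>2"
    if "x \<in> cball 0 r0" for x
  proof -
    define den where "den = (lambda_max \<Gamma>)\<^sup>2 - \<epsilon> * lambda_min \<Gamma>"
    have x: "norm x \<le> r0" using that by simp
    have r0: "r0 = (if den = 0 then r else min r (sqrt (lambda_max \<Gamma> * lambda_min \<Gamma> / den) * r))"
      using assms(27) by (simp add: den_def Let_def)
    have "(norm x)\<^sup>2 * den \<le> lambda_max \<Gamma> * lambda_min \<Gamma> * r\<^sup>2"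
    \<comment> \<open>For \<open>den \<le> 0\<close> the left-hand side is nonpositive; this
      includes \<open>den = 0\<close>, where the quotient is read as infinite and
      \<open>r0 = r\<close>.\<close>
    proof (cases "den \<le> 0")
      case True
      then have "(norm x)\<^sup>2 * den \<le> 0" by (simp add: mult_nonneg_nonpos)
      also have "0 \<le> lambda_max \<Gamma> * lambda_min \<Gamma> * r\<^sup>2" using M m by simp
      finally show ?thesis .
    next
      case False
      then have "norm x \<le> sqrt (lambda_max \<Gamma> * lambda_min \<Gamma> / den) * r" using x r0 by simp
      then have "(norm x)\<^sup>2 \<le> (sqrt (lambda_max \<Gamma> * lambda_min \<Gamma> / den) * r)\<^sup>2"
        by (rule power_mono) simp
      also have "\<dots> = lambda_max \<Gamma> * lambda_min \<Gamma> / den * r\<^sup>2"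
        using False M m by (simp add: power_mult_distrib)
      finally show ?thesis using False by (simp add: field_simps)
    qed
    moreover have "norm x \<le> r" using x r0 by (simp split: if_splits)
    ultimately show ?thesis by (simp add: den_def)
  qed
  obtain c \<rho> where "0 < c" "0 < \<rho>" "\<rho> < 1"
    and "\<And>x k. x \<in> cball 0 r0 \<Longrightarrow> norm ((?f ^^ k) x) \<le> r \<and> norm ((?f ^^ k) x) \<le> c * \<rho> ^ k * norm x"
    using quadratic_decrease_imp_exp_decay[where V = V and f = ?f and R = "cball 0 r0",
        OF m M assms(24,21) bounds(1)[folded V_def] bounds(2)[folded V_def] decr R] by blast
  then have "exp_converges_to_origin X ?f (cball 0 r0)"
    unfolding exp_converges_to_origin_def using assms(22)
    by (intro exI[of _ c] exI[of _ \<rho>]) (auto simp: subset_iff)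
  with exp_decay_imp_attraction[OF assms(1) _ this] show ?thesis by simp
qed

end
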